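(* Let $G=(V,E,w)$ be a graph and fix $p\in[1,\infty)$. Then $d_p$ is $p$-strong, i.e. $$\forall s,t,v\in V,\quad d_p(s,t)^p\leq d_p(s,v)^p+d_p(v,t)^p.$$
   Context: Graphs are connected with positive edge weights. For $p\in[1,\infty)$, $d_p(s,t)=\min\{(\sum_{e\in E}|f(e)/w(e)|^p)^{1/p}: f \text{ a flow shipping one unit from } s \text{ to } t\}$, where a flow shipping one unit from $s$ to $t$ is $f:E\to\mathbb{R}$ (w.r.t. a fixed orientation) with conservation at all vertices other than $s,t$, net outflow $1$ at $s$ and $-1$ at $t$. *)

theory Defs
  imports "HOL-Analysis.Analysis"
begin

text \<open>
  A finite simple undirected connected graph; an edge is the set of its two endpoints. The map
  \<open>ori\<close> is the fixed orientation: it lists the endpoints of an edge as (tail, head). Weights,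
  orientations and flows are total functions of which only the values on \<open>E\<close> matter.
\<close>

locale weighted_graph =
  fixes V :: "'a set" and E :: "'a set set" and w :: "'a set \<Rightarrow> real"
    and ori :: "'a set \<Rightarrow> 'a \<times> 'a"
  assumes finite_V: "finite V"
    and edges: "e \<in> E \<Longrightarrow> e \<subseteq> V \<and> card e = 2"
    and weight_pos: "e \<in> E \<Longrightarrow> 0 < w e"
    and connected: "u \<in> V \<Longrightarrow> v \<in> V \<Longrightarrow> (u, v) \<in> {(x, y). {x, y} \<in> E}\<^sup>*"
    and orientation: "e \<in> E \<Longrightarrow> {fst (ori e), snd (ori e)} = e"

definition net_outflow ::
  "'a set set \<Rightarrow> ('a set \<Rightarrow> 'a \<times> 'a) \<Rightarrow> ('a set \<Rightarrow> real) \<Rightarrow> 'a \<Rightarrow> real" where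
  "net_outflow E ori f x =
     (\<Sum>e\<in>{e \<in> E. fst (ori e) = x}. f e) - (\<Sum>e\<in>{e \<in> E. snd (ori e) = x}. f e)"

definition unit_flow ::
  "'a set \<Rightarrow> 'a set set \<Rightarrow> ('a set \<Rightarrow> 'a \<times> 'a) \<Rightarrow> 'a \<Rightarrow> 'a \<Rightarrow> ('a set \<Rightarrow> real) \<Rightarrow> bool" where
  "unit_flow V E ori s t f \<longleftrightarrow>
     (\<forall>x\<in>V - {s, t}. net_outflow E ori f x = 0) \<and>
     net_outflow E ori f s = 1 \<and> net_outflow E ori f t = -1"

definition flow_norm ::
  "'a set set \<Rightarrow> ('a set \<Rightarrow> real) \<Rightarrow> real \<Rightarrow> ('a set \<Rightarrow> real) \<Rightarrow> real" where
  "flow_norm E w p f = (\<Sum>e\<in>E. \<bar>f e / w e\<bar> powr p) powr (1 / p)"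

text \<open>
  For \<open>s = t\<close> no function is a unit flow (the net outflow at \<open>s\<close> would be both 1 and -1), so the
  usual convention that the distance of a vertex to itself is 0 is made explicit. For distinct
  vertices the infimum is a minimum: see \<open>flow_dist_attained\<close> below.
\<close>

definition flow_dist ::
  "'a set \<Rightarrow> 'a set set \<Rightarrow> ('a set \<Rightarrow> real) \<Rightarrow> ('a set \<Rightarrow> 'a \<times> 'a) \<Rightarrow> real \<Rightarrow> 'a \<Rightarrow> 'a \<Rightarrow> real" where
  "flow_dist V E w ori p s t =
     (if s = t then 0 else Inf {flow_norm E w p f | f. unit_flow V E ori s t f})"

definition p_strong :: "real \<Rightarrow> 'a set \<Rightarrow> ('a \<Rightarrow> 'a \<Rightarrow> real) \<Rightarrow> bool" where
  "p_strong p V d \<longleftrightarrow>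
     (\<forall>s\<in>V. \<forall>t\<in>V. \<forall>v\<in>V. d s t powr p \<le> d s v powr p + d v t powr p)"

context weighted_graph
begin

lemma finite_E: "finite E"
  using edges finite_V by (meson Pow_iff finite_Pow_iff finite_subset subsetI)

lemma unit_flow_exists:
  assumes "s \<in> V" "t \<in> V" "s \<noteq> t"
  shows "\<exists>f. unit_flow V E ori s t f"
proof -
  have "(s, t) \<in> {(x, y). {x, y} \<in> E}\<^sup>*"
    using assms connected by blast
  then have "\<exists>f. \<forall>x. net_outflow E ori f x = of_bool (x = s) - of_bool (x = t)"
  proof (induction rule: rtrancl_induct)
    case base
    show ?case by (rule exI[of _ "\<lambda>_. 0"]) (simp add: net_outflow_def)
  next
    case (step y z)
    then obtain f where f: "\<And>x. net_outflow E ori f x = of_bool (x = s) - of_bool (x = y)"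
      by auto
    define e0 where "e0 = {y, z}"
    have e0: "e0 \<in> E" using step e0_def by simp
    have ne: "y \<noteq> z" using edges[OF e0] by (auto simp: e0_def)
    have ends: "(fst (ori e0) = y \<and> snd (ori e0) = z) \<or> (fst (ori e0) = z \<and> snd (ori e0) = y)"
      using orientation[OF e0] by (simp add: e0_def doubleton_eq_iff)
    define c :: real where "c = (if fst (ori e0) = y then 1 else -1)"
    define g where "g = (\<lambda>e. f e + (if e = e0 then c else 0))"
    have 1: "(\<Sum>e\<in>{e \<in> E. P e}. g e) = (\<Sum>e\<in>{e \<in> E. P e}. f e) + (if P e0 then c else 0)" for P
      using finite_E e0 by (simp add: g_def sum.distrib)
    have "net_outflow E ori g x = of_bool (x = s) - of_bool (x = z)" for x
      using f[of x] ends ne by (auto simp: net_outflow_def 1 c_def)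
    then show ?case by blast
  qed
  then obtain f where "\<forall>x. net_outflow E ori f x = of_bool (x = s) - of_bool (x = t)" ..
  then have "unit_flow V E ori s t f"
    using assms(3) by (auto simp: unit_flow_def)
  then show ?thesis by blast
qed

lemma flow_dist_attained:
  assumes st: "s \<in> V" "t \<in> V" "s \<noteq> t" and p: "1 \<le> p"
  shows "\<exists>f. unit_flow V E ori s t f \<and> flow_dist V E w ori p s t = flow_norm E w p f \<and>
           (\<forall>g. unit_flow V E ori s t g \<longrightarrow> flow_norm E w p f \<le> flow_norm E w p g)"
proof -
  let ?U = "unit_flow V E ori s t" and ?N = "flow_norm E w p"
  obtain f0 where f0: "?U f0" using unit_flow_exists[OF st] by blast
  define B where "B e = ?N f0 * w e" for e
  define K where "K = (\<Pi>\<^sub>E e\<in>UNIV. if e \<in> E then {- B e..B e} else {0::real})"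
  define C where "C = K \<inter> {f. ?U f}"
  define r where "r f = (\<lambda>e. if e \<in> E then f e else 0)" for f :: "'a set \<Rightarrow> real"
  have coord: "continuous_on UNIV (\<lambda>f::'a set \<Rightarrow> real. f e)" for e
    by (rule continuous_on_product_coordinates)
  have cont_net: "continuous_on UNIV (\<lambda>f. net_outflow E ori f x)" for x
    unfolding net_outflow_def by (intro continuous_intros coord)
  have cont_norm: "continuous_on UNIV ?N"
    unfolding flow_norm_def using p
    by (intro continuous_on_powr' continuous_on_sum continuous_intros coord
          continuous_on_divide) (auto simp: sum_nonneg dest: weight_pos)
  have "compact K"
    using compactin_PiE[of "\<lambda>_::'a set. euclidean :: real topology" UNIV
        "\<lambda>e. if e \<in> E then {- B e..B e} else {0::real}"]
    by (auto simp: K_def euclidean_product_topology)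
  moreover have "closed {f. ?U f}"
    unfolding unit_flow_def Ball_def
    by (intro closed_Collect_conj closed_Collect_all closed_Collect_imp closed_Collect_eq
        cont_net open_Collect_const continuous_on_const)
  ultimately have "compact C" unfolding C_def by blast
  have r_net: "net_outflow E ori (r f) = net_outflow E ori f" for f
    by (rule ext) (auto simp: net_outflow_def r_def intro!: arg_cong2[where f = "(-)"] sum.cong)
  have r_U: "?U (r f) = ?U f" for f by (simp add: unit_flow_def r_net)
  have r_N: "?N (r f) = ?N f" for f by (simp add: flow_norm_def r_def)
  have comp_le: "\<bar>f e\<bar> \<le> ?N f * w e" if "e \<in> E" for f e
  proof -
    have "\<bar>f e / w e\<bar> = (\<bar>f e / w e\<bar> powr p) powr (1 / p)"
      using p by (simp add: powr_powr)
    also have "\<dots> \<le> ?N f"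
      unfolding flow_norm_def using p finite_E that
      by (intro powr_mono2 member_le_sum) auto
    finally show ?thesis
      using weight_pos[OF that] by (simp add: abs_divide divide_simps split: if_splits)
  qed
  have inC: "r g \<in> C" if "?U g" "?N g \<le> ?N f0" for g
  proof -
    have "\<bar>g e\<bar> \<le> B e" if "e \<in> E" for e
      using comp_le[OF that, of g] mult_right_mono[OF \<open>?N g \<le> ?N f0\<close>, of "w e"] weight_pos[OF that]
      unfolding B_def by linarith
    then show ?thesis using that by (auto simp: C_def K_def r_U) (auto simp: r_def abs_le_iff minus_le_iff)
  qed
  obtain f where f: "f \<in> C" "\<And>g. g \<in> C \<Longrightarrow> ?N f \<le> ?N g"
    using continuous_attains_inf[OF \<open>compact C\<close>, of ?N] inC[OF f0]
      continuous_on_subset[OF cont_norm, of C] by auto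
  have U: "?U f" using f(1) by (simp add: C_def)
  have le: "?N f \<le> ?N g" if "?U g" for g
    using f(2)[OF inC[OF that]] f(2)[OF inC[OF f0]] r_N[of g] r_N[of f0] by fastforce
  have "Inf {?N f | f. ?U f} = ?N f"
    using U le by (intro cInf_eq_minimum) auto
  then show ?thesis using U le st(3) by (auto simp: flow_dist_def)
qed

end

end

theory Submission
  imports Defs
begin

text \<open>
  For \<open>p = 1\<close> one concatenates optimal flows. For \<open>p > 1\<close>, stationarity of an optimal flow \<open>f\<close>
  from \<open>s\<close> to \<open>t\<close> says that its gradient \<open>sgn f \<bar>f / w\<bar>\<^sup>p\<^sup>-\<^sup>1 / w\<close> is orthogonal to all circulations,
  hence is the difference of a potential \<open>\<phi>\<close>, and the energy \<open>\<Sum> \<bar>f / w\<bar>\<^sup>p\<close> equals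
  \<open>\<phi> s - \<phi> t = (\<phi> s - \<phi> v) + (\<phi> v - \<phi> t)\<close>. Pairing an arbitrary unit flow \<open>h\<close> from \<open>s\<close> to \<open>v\<close> with
  the truncation \<open>max \<phi> (\<phi> v)\<close> and applying Young's inequality edge by edge shows that
  \<open>\<phi> s - \<phi> v\<close> is at most the energy of \<open>h\<close>; the other difference is symmetric.
\<close>

section \<open>Calculus of the p-th power of the absolute value\<close>

lemma has_real_derivative_abs_powr:
  fixes x p :: real
  assumes p: "1 < p"
  shows "((\<lambda>x. \<bar>x\<bar> powr p) has_real_derivative p * (sgn x * \<bar>x\<bar> powr (p - 1))) (at x)"
proof -
  consider "x > 0" | "x < 0" | "x = 0" by linarith
  then show ?thesis
  proof cases
    case 1
    have "((\<lambda>x. x powr p) has_real_derivative p * x powr (p - 1)) (at x)"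
      using 1 by (rule has_real_derivative_powr)
    then have "((\<lambda>x. \<bar>x\<bar> powr p) has_real_derivative p * x powr (p - 1)) (at x)"
      by (rule has_field_derivative_transform_within_open[where S = "{0<..}"]) (use 1 in auto)
    then show ?thesis using 1 by simp
  next
    case 2
    have "((\<lambda>x. (- x) powr p) has_real_derivative (p * (- x) powr (p - 1)) * (- 1)) (at x)"
      by (rule DERIV_chain2[OF has_real_derivative_powr]) (use 2 in \<open>auto intro!: derivative_eq_intros\<close>)
    then have "((\<lambda>x. \<bar>x\<bar> powr p) has_real_derivative (p * (- x) powr (p - 1)) * (- 1)) (at x)"
      by (rule has_field_derivative_transform_within_open[where S = "{..<0}"]) (use 2 in auto)
    then show ?thesis using 2 by simp
  next
    case 3
    \<comment> \<open>At zero the difference quotient is \<open>\<bar>h\<bar> powr p / h\<close>,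
      bounded by \<open>\<bar>h\<bar> powr (p - 1)\<close>; the bound tends to 0 because p >
      1.\<close>
    have "((\<lambda>h::real. \<bar>h\<bar> powr (p - 1)) \<longlongrightarrow> \<bar>0\<bar> powr (p - 1)) (at 0)"
      using p by (intro tendsto_powr' tendsto_intros) auto
    then have lim: "((\<lambda>h::real. \<bar>h\<bar> powr (p - 1)) \<longlongrightarrow> 0) (at 0)" by simp
    have "norm (\<bar>h\<bar> powr p / h) \<le> \<bar>h\<bar> powr (p - 1)" for h :: real
      by (cases "h = 0") (auto simp: powr_diff)
    then have "((\<lambda>h::real. \<bar>h\<bar> powr p / h) \<longlongrightarrow> 0) (at 0)"
      by (intro Lim_null_comparison[OF always_eventually lim] allI)
    then show ?thesis using 3 p by (simp add: DERIV_def)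
  qed
qed

text \<open>Young's inequality with conjugate exponents p and p / (p - 1), multiplied by p.
  Geometrically, the convex function x^p lies above its tangent at \<open>b\<close>.\<close>

lemma powr_tangent_le:
  fixes a b p :: real
  assumes p: "1 < p" and "0 \<le> a" "0 \<le> b"
  shows "p * (a * b powr (p - 1)) \<le> a powr p + (p - 1) * b powr p"
proof -
  have q: "p / (p - 1) > 1" "1 / p + 1 / (p / (p - 1)) = 1"
    using p by (auto simp: field_simps)
  have "a * b powr (p - 1) \<le> a powr p / p + (b powr (p - 1)) powr (p / (p - 1)) / (p / (p - 1))"
    using assms q by (intro Youngs_inequality) auto
  also have "(b powr (p - 1)) powr (p / (p - 1)) = b powr p"
    using p by (simp add: powr_powr)
  finally show ?thesis using p by (simp add: field_simps)
qed

section \<open>Energies and linear operations on flows\<close>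

definition flow_energy ::
  "'a set set \<Rightarrow> ('a set \<Rightarrow> real) \<Rightarrow> real \<Rightarrow> ('a set \<Rightarrow> real) \<Rightarrow> real" where
  "flow_energy E w p f = (\<Sum>e\<in>E. \<bar>f e / w e\<bar> powr p)"

lemma flow_energy_nonneg: "0 \<le> flow_energy E w p f"
  by (simp add: flow_energy_def sum_nonneg)

text \<open>Replaces p-th powers of distances by energies, which are plain sums over edges and can
  be differentiated and estimated edge by edge.\<close>

lemma flow_norm_powr: "p \<noteq> 0 \<Longrightarrow> flow_norm E w p f powr p = flow_energy E w p f"
  using flow_energy_nonneg[of E w p f] by (simp add: flow_norm_def flow_energy_def powr_powr)

lemma flow_energy_uminus: "flow_energy E w p (\<lambda>e. - f e) = flow_energy E w p f"
  by (simp add: flow_energy_def)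

lemma net_outflow_add:
  "net_outflow E ori (\<lambda>e. f e + g e) x = net_outflow E ori f x + net_outflow E ori g x"
  by (simp add: net_outflow_def sum.distrib)

lemma net_outflow_diff:
  "net_outflow E ori (\<lambda>e. f e - g e) x = net_outflow E ori f x - net_outflow E ori g x"
  by (simp add: net_outflow_def sum_subtractf)

lemma net_outflow_uminus:
  "net_outflow E ori (\<lambda>e. - f e) x = - net_outflow E ori f x"
  by (simp add: net_outflow_def sum_negf)

lemma net_outflow_cmult:
  "net_outflow E ori (\<lambda>e. c * f e) x = c * net_outflow E ori f x"
  by (simp add: net_outflow_def sum_distrib_left right_diff_distrib)

lemma unit_flow_uminus: "unit_flow V E ori s t f \<Longrightarrow> unit_flow V E ori t s (\<lambda>e. - f e)"
  by (auto simp: unit_flow_def net_outflow_uminus)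

lemma unit_flow_add_circulation:
  assumes "unit_flow V E ori s t f" "s \<in> V" "t \<in> V" "\<And>x. x \<in> V \<Longrightarrow> net_outflow E ori c x = 0"
  shows "unit_flow V E ori s t (\<lambda>e. f e + c e)"
  using assms by (auto simp: unit_flow_def net_outflow_add)

lemma unit_flow_concat:
  assumes "unit_flow V E ori s v f" "unit_flow V E ori v t g"
    "s \<in> V" "t \<in> V" "s \<noteq> t" "s \<noteq> v" "v \<noteq> t"
  shows "unit_flow V E ori s t (\<lambda>e. f e + g e)"
proof -
  \<comment> \<open>At \<open>v\<close> the net outflow -1 of \<open>f\<close> cancels the net
    outflow 1 of \<open>g\<close>.\<close>
  have "net_outflow E ori f x + net_outflow E ori g x = 0" if "x \<in> V - {s, t}" for x
    using that assms by (cases "x = v") (auto simp: unit_flow_def)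
  then show ?thesis
    using assms by (auto simp: unit_flow_def net_outflow_add)
qed

section \<open>Potentials, gradients and stationarity\<close>

context weighted_graph
begin

definition grad :: "('a \<Rightarrow> real) \<Rightarrow> 'a set \<Rightarrow> real" where
  "grad \<psi> e = \<psi> (fst (ori e)) - \<psi> (snd (ori e))"

lemma ori_in_V:
  assumes "e \<in> E" shows "fst (ori e) \<in> V" "snd (ori e) \<in> V"
  using edges[OF assms] orientation[OF assms] by blast+

text \<open>Discrete summation by parts: group the edges once by tail and once by head.\<close>

lemma sum_flow_grad:
  "(\<Sum>e\<in>E. f e * grad \<psi> e) = (\<Sum>x\<in>V. \<psi> x * net_outflow E ori f x)"
proof -
  have "(\<Sum>e\<in>E. f e * \<psi> (\<pi> (ori e))) = (\<Sum>x\<in>V. \<psi> x * (\<Sum>e\<in>{e \<in> E. \<pi> (ori e) = x}. f e))"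
    if "\<And>e. e \<in> E \<Longrightarrow> \<pi> (ori e) \<in> V" for \<pi>
  proof -
    have "(\<Sum>e\<in>E. f e * \<psi> (\<pi> (ori e)))
        = (\<Sum>x\<in>V. \<Sum>e\<in>{e \<in> E. \<pi> (ori e) = x}. f e * \<psi> (\<pi> (ori e)))"
      using that by (intro sum.group[symmetric] finite_E finite_V) auto
    then show ?thesis by (simp add: sum_distrib_left mult.commute)
  qed
  from this[of fst] this[of snd] show ?thesis
    using ori_in_V by (simp add: grad_def net_outflow_def right_diff_distrib sum_subtractf)
qed

lemma sum_unit_flow_grad:
  assumes "unit_flow V E ori s t f" "s \<in> V" "t \<in> V"
  shows "(\<Sum>e\<in>E. f e * grad \<psi> e) = \<psi> s - \<psi> t"
proof -
  have "s \<noteq> t" using assms(1) by (auto simp: unit_flow_def)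
  have "(\<Sum>x\<in>V. \<psi> x * net_outflow E ori f x) = (\<Sum>x\<in>{s, t}. \<psi> x * net_outflow E ori f x)"
    using assms finite_V by (intro sum.mono_neutral_right) (auto simp: unit_flow_def)
  also have "\<dots> = \<psi> s - \<psi> t"
    using assms(1) \<open>s \<noteq> t\<close> by (simp add: unit_flow_def)
  finally show ?thesis by (simp add: sum_flow_grad)
qed

lemma net_outflow_single:
  assumes "e0 \<in> E"
  shows "net_outflow E ori (\<lambda>e. of_bool (e = e0)) x
    = of_bool (fst (ori e0) = x) - of_bool (snd (ori e0) = x)"
proof -
  have "(\<Sum>e\<in>{e \<in> E. P e}. of_bool (e = e0)) = (of_bool (P e0) :: real)" for P
    using assms finite_E by (simp add: of_bool_def)
  then show ?thesis by (simp add: net_outflow_def)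
qed

text \<open>By connectedness every vertex x can ship one unit to the fixed root \<open>t\<close> by
  some \<open>k x\<close>; the pairing of \<open>y\<close> with \<open>k x\<close> serves as the
  potential at x. For an edge from u to v, \<open>k u - k v\<close> minus the unit flow on that edge
  is a circulation, so orthogonality identifies the value of \<open>y\<close> on the edge with the
  potential difference.\<close>

lemma orthogonal_circulations_imp_grad:
  assumes "t \<in> V"
    and orth: "\<And>c. (\<And>x. x \<in> V \<Longrightarrow> net_outflow E ori c x = 0) \<Longrightarrow> (\<Sum>e\<in>E. y e * c e) = 0"
  obtains \<phi> where "\<And>e. e \<in> E \<Longrightarrow> y e = grad \<phi> e"
proof -
  \<comment> \<open>The root itself gets the zero function, since no unit flow from \<open>t\<close>
    to \<open>t\<close> exists.\<close>
  have "\<exists>k. \<forall>z\<in>V. net_outflow E ori k z = of_bool (z = x) - of_bool (z = t)" if x: "x \<in> V" for x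
  proof (cases "x = t")
    case True
    then show ?thesis by (intro exI[of _ "\<lambda>_. 0"]) (simp add: net_outflow_def)
  next
    case False
    then show ?thesis
      using unit_flow_exists[OF x \<open>t \<in> V\<close>] by (force simp: unit_flow_def)
  qed
  then obtain k where k: "\<And>x z. x \<in> V \<Longrightarrow> z \<in> V \<Longrightarrow>
      net_outflow E ori (k x) z = of_bool (z = x) - of_bool (z = t)"
    by metis
  define \<phi> where "\<phi> x = (\<Sum>e\<in>E. y e * k x e)" for x
  have "y e0 = grad \<phi> e0" if e0: "e0 \<in> E" for e0
  proof -
    let ?u = "fst (ori e0)" and ?v = "snd (ori e0)"
    have "(\<Sum>e\<in>E. y e * (k ?u e - k ?v e - of_bool (e = e0))) = 0"
      by (rule orth) (use e0 k ori_in_V in \<open>auto simp: net_outflow_diff net_outflow_single\<close>)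
    then have "\<phi> ?u - \<phi> ?v - (\<Sum>e\<in>E. y e * of_bool (e = e0)) = 0"
      by (simp add: \<phi>_def right_diff_distrib sum_subtractf)
    moreover have "(\<Sum>e\<in>E. y e * of_bool (e = e0)) = y e0"
      using e0 finite_E by simp
    ultimately show ?thesis by (simp add: grad_def)
  qed
  then show ?thesis by (rule that)
qed

text \<open>For p > 1, the partial derivative of \<open>flow_energy\<close> in the value at
  \<open>e\<close>, divided by p. Without the factor p, pairing it with \<open>f\<close> gives
  exactly the energy of \<open>f\<close>.\<close>

definition energy_grad :: "real \<Rightarrow> ('a set \<Rightarrow> real) \<Rightarrow> 'a set \<Rightarrow> real" where
  "energy_grad p f e = sgn (f e / w e) * \<bar>f e / w e\<bar> powr (p - 1) / w e"

lemma energy_grad_uminus: "energy_grad p (\<lambda>e. - f e) e = - energy_grad p f e"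
  by (simp add: energy_grad_def sgn_minus)

lemma flow_times_energy_grad:
  "f e * energy_grad p f e = \<bar>f e / w e\<bar> powr p"
proof -
  have "f e * energy_grad p f e = f e / w e * sgn (f e / w e) * \<bar>f e / w e\<bar> powr (p - 1)"
    by (simp add: energy_grad_def)
  also have "f e / w e * sgn (f e / w e) = \<bar>f e / w e\<bar>"
    by (rule abs_sgn[symmetric])
  also have "\<bar>f e / w e\<bar> * \<bar>f e / w e\<bar> powr (p - 1) = \<bar>f e / w e\<bar> powr p"
    by (cases "f e / w e = 0") (auto simp: powr_diff)
  finally show ?thesis .
qed

text \<open>Along the line \<open>f + r * c\<close> the energy is differentiable, as p > 1, and
  minimal at r = 0, so its derivative there vanishes.\<close>

lemma minimal_energy_imp_orthogonal:
  assumes p: "1 < p"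
    and min: "\<And>r. flow_energy E w p f \<le> flow_energy E w p (\<lambda>e. f e + r * c e)"
  shows "(\<Sum>e\<in>E. energy_grad p f e * c e) = 0"
proof -
  have "((\<lambda>r. \<bar>(f e + r * c e) / w e\<bar> powr p) has_real_derivative
      p * (energy_grad p f e * c e)) (at 0)" for e
  proof -
    have "((\<lambda>r. (f e + r * c e) / w e) has_real_derivative c e / w e) (at 0)"
      by (intro DERIV_cdivide) (auto intro!: derivative_eq_intros)
    from DERIV_chain2[OF has_real_derivative_abs_powr[OF p] this] show ?thesis
      by (simp add: energy_grad_def mult_ac)
  qed
  then have "((\<lambda>r. flow_energy E w p (\<lambda>e. f e + r * c e)) has_real_derivative
      (\<Sum>e\<in>E. p * (energy_grad p f e * c e))) (at 0)"
    unfolding flow_energy_def by (intro DERIV_sum)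
  then have "(\<Sum>e\<in>E. p * (energy_grad p f e * c e)) = 0"
    by (rule DERIV_local_min[where d = 1]) (use min in auto)
  then show ?thesis using p by (simp flip: sum_distrib_left)
qed

section \<open>Bounding a potential drop by an energy\<close>

lemma truncated_edge_bound:
  assumes p: "1 < p" and "0 \<le> \<theta>" "\<theta> \<le> 1"
  shows "p * (h e * (\<theta> * energy_grad p f e))
    \<le> \<bar>h e / w e\<bar> powr p + (p - 1) * (f e * (\<theta> * energy_grad p f e))"
proof -
  let ?F = "\<bar>f e / w e\<bar>" and ?H = "\<bar>h e / w e\<bar>"
  have "h e * energy_grad p f e \<le> \<bar>h e * energy_grad p f e\<bar>" by simp
  also have "\<dots> \<le> ?H * ?F powr (p - 1)"
    by (auto simp: energy_grad_def abs_mult abs_sgn_eq)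
  finally have "p * (h e * energy_grad p f e) \<le> p * (?H * ?F powr (p - 1))"
    using p by (intro mult_left_mono) auto
  also have "\<dots> \<le> ?H powr p + (p - 1) * ?F powr p"
    using p by (intro powr_tangent_le) auto
  finally have "\<theta> * (p * (h e * energy_grad p f e)) \<le> \<theta> * (?H powr p + (p - 1) * ?F powr p)"
    using assms by (intro mult_left_mono)
  \<comment> \<open>The factor \<open>\<theta>\<close> is dropped only from the energy of
    \<open>h\<close>; the term of \<open>f\<close> keeps it, so that it again becomes a pairing with
    the truncated gradient.\<close>
  also have "\<dots> \<le> ?H powr p + (p - 1) * (\<theta> * ?F powr p)"
    using assms by (simp add: distrib_left mult_left_le_one_le mult.left_commute)
  finally show ?thesis
    unfolding flow_times_energy_grad[of f e p, symmetric] by (simp only: mult_ac)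
qed

text \<open>Summed over all edges, the edge bound turns both pairings into drops of the truncated
  potential: from \<open>s\<close> to \<open>v\<close> for \<open>h\<close>, from \<open>s\<close>
  to \<open>t\<close> for \<open>f\<close>.\<close>

lemma potential_drop_le_energy:
  assumes p: "1 < p" and V: "s \<in> V" "t \<in> V" "v \<in> V"
    and f: "unit_flow V E ori s t f" and h: "unit_flow V E ori s v h"
    and \<phi>: "\<And>e. e \<in> E \<Longrightarrow> energy_grad p f e = grad \<phi> e"
  shows "\<phi> s - \<phi> v \<le> flow_energy E w p h"
proof (cases "\<phi> s \<le> \<phi> v")
  case True
  then show ?thesis using flow_energy_nonneg[of E w p h] by linarith
next
  case False
  define \<psi> where "\<psi> x = max (\<phi> x) (\<phi> v)" for x
  have edge: "p * (h e * grad \<psi> e) \<le> \<bar>h e / w e\<bar> powr p + (p - 1) * (f e * grad \<psi> e)"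
    if e: "e \<in> E" for e
  proof -
    \<comment> \<open>Truncation is monotone and 1-Lipschitz, so on each edge the difference keeps
      its sign, unless it becomes 0, and does not grow.\<close>
    have "\<exists>\<theta>. 0 \<le> \<theta> \<and> \<theta> \<le> 1 \<and> grad \<psi> e = \<theta> * grad \<phi> e"
    proof (cases "grad \<phi> e = 0")
      case True
      then show ?thesis by (intro exI[of _ 0]) (simp add: grad_def \<psi>_def)
    next
      case False
      then show ?thesis
        by (intro exI[of _ "grad \<psi> e / grad \<phi> e"])
          (auto simp: grad_def \<psi>_def max_def divide_simps)
    qed
    then show ?thesis using truncated_edge_bound[OF p] \<phi>[OF e] by metis
  qed
  have "p * (\<psi> s - \<psi> v) = (\<Sum>e\<in>E. p * (h e * grad \<psi> e))"
    by (simp add: sum_unit_flow_grad[OF h V(1,3)] flip: sum_distrib_left)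
  also have "\<dots> \<le> (\<Sum>e\<in>E. \<bar>h e / w e\<bar> powr p + (p - 1) * (f e * grad \<psi> e))"
    by (intro sum_mono edge)
  also have "\<dots> = flow_energy E w p h + (p - 1) * (\<psi> s - \<psi> t)"
    by (simp add: sum.distrib flow_energy_def sum_unit_flow_grad[OF f V(1,2)] flip: sum_distrib_left)
  \<comment> \<open>Truncating from below gives \<open>\<psi> t \<ge> \<phi> v = \<psi> v\<close>.
    Now p - 1 of the p copies of the drop from \<open>s\<close> to \<open>v\<close> cancel.\<close>
  also have "\<dots> \<le> flow_energy E w p h + (p - 1) * (\<psi> s - \<psi> v)"
    using p by (simp add: \<psi>_def)
  finally have "\<psi> s - \<psi> v \<le> flow_energy E w p h" by (simp add: algebra_simps)
  then show ?thesis using False by (simp add: \<psi>_def)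
qed

section \<open>The inequality for minimal flows\<close>

lemma minimal_energy_flow:
  assumes "s \<in> V" "t \<in> V" "s \<noteq> t" "1 \<le> p"
  obtains f where "unit_flow V E ori s t f"
    "flow_dist V E w ori p s t powr p = flow_energy E w p f"
    "\<And>g. unit_flow V E ori s t g \<Longrightarrow> flow_energy E w p f \<le> flow_energy E w p g"
proof -
  obtain f where f: "unit_flow V E ori s t f"
    "flow_dist V E w ori p s t = flow_norm E w p f"
    "\<And>g. unit_flow V E ori s t g \<Longrightarrow> flow_norm E w p f \<le> flow_norm E w p g"
    using flow_dist_attained[OF assms] by blast
  have "flow_energy E w p f \<le> flow_energy E w p g" if "unit_flow V E ori s t g" for g
  proof -
    have "flow_norm E w p f powr p \<le> flow_norm E w p g powr p"
      using assms f(3)[OF that] by (intro powr_mono2) (auto simp: flow_norm_def)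
    then show ?thesis using assms by (simp add: flow_norm_powr)
  qed
  then show ?thesis using that f assms by (auto simp: flow_norm_powr)
qed

lemma minimal_energy_le_sum:
  assumes p: "1 \<le> p" and V: "s \<in> V" "t \<in> V" "v \<in> V" and ne: "s \<noteq> t" "s \<noteq> v" "v \<noteq> t"
    and f: "unit_flow V E ori s t f"
    and min: "\<And>g. unit_flow V E ori s t g \<Longrightarrow> flow_energy E w p f \<le> flow_energy E w p g"
    and g: "unit_flow V E ori s v g" and h: "unit_flow V E ori v t h"
  shows "flow_energy E w p f \<le> flow_energy E w p g + flow_energy E w p h"
proof (cases "p = 1")
  case True
  have "flow_energy E w p f \<le> flow_energy E w p (\<lambda>e. g e + h e)"
    using g h V ne by (intro min unit_flow_concat)
  also have "\<dots> \<le> flow_energy E w p g + flow_energy E w p h"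
    unfolding flow_energy_def True sum.distrib[symmetric]
    by (intro sum_mono) (simp add: add_divide_distrib del: abs_divide)
  finally show ?thesis .
next
  case False
  with p have p: "1 < p" by simp
  \<comment> \<open>Every multiple of a circulation can be added to \<open>f\<close> without leaving
    the unit flows from \<open>s\<close> to \<open>t\<close>, so minimality applies for all
    \<open>r\<close>.\<close>
  have "(\<Sum>e\<in>E. energy_grad p f e * c e) = 0" if "\<And>x. x \<in> V \<Longrightarrow> net_outflow E ori c x = 0" for c
    using that f V
    by (intro minimal_energy_imp_orthogonal p min unit_flow_add_circulation)
      (auto simp: net_outflow_cmult)
  then obtain \<phi> where \<phi>: "\<And>e. e \<in> E \<Longrightarrow> energy_grad p f e = grad \<phi> e"
    using orthogonal_circulations_imp_grad[OF V(2), of "energy_grad p f"] by metis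
  have "flow_energy E w p f = (\<Sum>e\<in>E. f e * grad \<phi> e)"
    unfolding flow_energy_def by (intro sum.cong) (simp_all only: flow_times_energy_grad flip: \<phi>)
  also have "\<dots> = \<phi> s - \<phi> t"
    using f V by (intro sum_unit_flow_grad)
  finally have "flow_energy E w p f = \<phi> s - \<phi> t" .
  moreover have "\<phi> s - \<phi> v \<le> flow_energy E w p g"
    using p V f g \<phi> by (rule potential_drop_le_energy)
  \<comment> \<open>Reversal swaps the roles of the endpoints: \<open>-f\<close> ships from
    \<open>t\<close> to \<open>s\<close>, \<open>-h\<close> from \<open>t\<close> to
    \<open>v\<close>, and \<open>-\<phi>\<close> is a potential for \<open>-f\<close>.\<close>
  moreover have "- \<phi> t - - \<phi> v \<le> flow_energy E w p (\<lambda>e. - h e)"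
    using p V(2,1,3) unit_flow_uminus[OF f] unit_flow_uminus[OF h]
    by (rule potential_drop_le_energy) (simp add: energy_grad_uminus \<phi> grad_def)
  ultimately show ?thesis by (simp add: flow_energy_uminus)
qed

end

theorem theorem2p15:
  fixes V :: "'a set" and E :: "'a set set" and w :: "'a set \<Rightarrow> real"
    and ori :: "'a set \<Rightarrow> 'a \<times> 'a" and p :: real
  assumes "weighted_graph V E w ori" and "1 \<le> p"
  shows "p_strong p V (flow_dist V E w ori p)"
  unfolding p_strong_def
proof (intro ballI)
  interpret weighted_graph V E w ori by fact
  fix s t v assume V: "s \<in> V" "t \<in> V" "v \<in> V"
  let ?d = "flow_dist V E w ori p"
  show "?d s t powr p \<le> ?d s v powr p + ?d v t powr p"
  proof (cases "s = t \<or> s = v \<or> v = t")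
    case True
    \<comment> \<open>A vertex has distance 0 to itself and \<open>0 powr p = 0\<close>: if
      \<open>v\<close> is an endpoint both sides agree, and if \<open>s = t\<close> the left side is
      0.\<close>
    then show ?thesis by (auto simp: flow_dist_def)
  next
    case False
    then have ne: "s \<noteq> t" "s \<noteq> v" "v \<noteq> t" by auto
    obtain f where f: "unit_flow V E ori s t f" "?d s t powr p = flow_energy E w p f"
      "\<And>g. unit_flow V E ori s t g \<Longrightarrow> flow_energy E w p f \<le> flow_energy E w p g"
      using minimal_energy_flow[OF V(1,2) ne(1) \<open>1 \<le> p\<close>] by metis
    obtain g where g: "unit_flow V E ori s v g" "?d s v powr p = flow_energy E w p g"
      using minimal_energy_flow[OF V(1,3) ne(2) \<open>1 \<le> p\<close>] by metis
    obtain h where h: "unit_flow V E ori v t h" "?d v t powr p = flow_energy E w p h"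
      using minimal_energy_flow[OF V(3,2) ne(3) \<open>1 \<le> p\<close>] by metis
    show ?thesis
      unfolding f(2) g(2) h(2)
      using minimal_energy_le_sum[OF \<open>1 \<le> p\<close> V ne f(1) f(3) g(1) h(1)] .
  qed
qed

end
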